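(* Let $\mathcal{X},\mathcal{Y}$ be finite alphabets, $P_{XY}$ any joint distribution on $\mathcal{X}\times\mathcal{Y}$, and $\mathcal{U}$ any metric space. Then $$\mathcal{L}_{\mathcal{U}}(X\to Y)\le\mathcal{L}(X\to Y),$$ with equality if $\mathcal{U}$ has a countably infinite subset $S$ such that no pair of (distinct) elements of $S$ is contained in a single closed unit ball of $\mathcal{U}$.
   Context: $\log$ is the natural logarithm. $U-X-Y$ denotes a Markov chain. The maximal leakage is $$\mathcal{L}(X\to Y)=\sup_{U-X-Y-\hat U}\log\frac{\Pr(U=\hat U)}{\max_{u}P_U(u)},$$ the supremum being over all $U,\hat U$ taking values in the same finite, but arbitrary, alphabet. For a metric space $\mathcal{U}$ equipped with its Borel $\sigma$-field, the maximal locational leakage is $$\mathcal{L}_{\mathcal{U}}(X\to Y)=\sup_{\substack{U:\,U-X-Y\\ \exists u:\ \Pr(U\in B(u))>0}}\log\frac{\sup_{\hat u(\cdot)}\Pr(U\in B(\hat u(Y)))}{\sup_{\hat u\in\mathcal{U}}\Pr(U\in B(\hat u))},$$ where $U$ ranges over $\mathcal{U}$-valued random variables, $\hat u(\cdot)$ over functions $\mathcal{Y}\to\mathcal{U}$, and $B(u)$ is the closed unit ball centered at $u\in\mathcal{U}$. *)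

theory Defs
  imports "HOL-Probability.Probability"
begin

text \<open>The library's \<^const>\<open>ln\<close> is total with \<^term>\<open>ln (0::real) = 0\<close>; leakages use the usual
  extended-real convention that the logarithm of 0 is minus infinity.\<close>

definition elog :: "real \<Rightarrow> ereal" where
  "elog r = (if r = 0 then - \<infinity> else ereal (ln r))"

text \<open>The Markov chain U - X - Y: U and Y are conditionally independent given X. U takes values in
  an arbitrary measurable space N; X and Y are discrete, so it suffices to consider singletons for
  them.\<close>

definition markov_chain ::
  "'w measure \<Rightarrow> 'u measure \<Rightarrow> ('w \<Rightarrow> 'u) \<Rightarrow> ('w \<Rightarrow> 'x) \<Rightarrow> ('w \<Rightarrow> 'y) \<Rightarrow> bool" where
  "markov_chain M N U X Y \<longleftrightarrow>
     (\<forall>A\<in>sets N. \<forall>x y. \<P>(\<omega> in M. X \<omega> = x) > 0 \<longrightarrow>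
        \<P>(\<omega> in M. U \<omega> \<in> A \<and> Y \<omega> = y \<bar> X \<omega> = x) =
        \<P>(\<omega> in M. U \<omega> \<in> A \<bar> X \<omega> = x) * \<P>(\<omega> in M. Y \<omega> = y \<bar> X \<omega> = x))"

text \<open>Joint laws of (U, X, Y, V) for which the law of (X, Y) is P, both U and V take values in the
  alphabet A, and U - X - Y - V is a Markov chain (Y is conditionally independent of U given X, and
  V is conditionally independent of (U, X) given Y).\<close>

definition guess_laws ::
  "('x \<times> 'y) pmf \<Rightarrow> 'a set \<Rightarrow> ('a \<times> 'x \<times> 'y \<times> 'a) pmf set" where
  "guess_laws P A = {Q.
     map_pmf (\<lambda>(u, x, y, v). (x, y)) Q = P \<and>
     set_pmf Q \<subseteq> A \<times> UNIV \<times> UNIV \<times> A \<and>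
     markov_chain (measure_pmf Q) (count_space UNIV)
       (\<lambda>(u, x, y, v). u) (\<lambda>(u, x, y, v). x) (\<lambda>(u, x, y, v). y) \<and>
     markov_chain (measure_pmf Q) (count_space UNIV)
       (\<lambda>(u, x, y, v). (u, x)) (\<lambda>(u, x, y, v). y) (\<lambda>(u, x, y, v). v)}"

text \<open>The supremum depends on the alphabet A only up to bijection, so letting A range over the
  finite sets of naturals covers all finite alphabets.\<close>

definition maximal_leakage :: "('x::finite \<times> 'y::finite) pmf \<Rightarrow> ereal" where
  "maximal_leakage P = Sup {elog
      (\<P>((u, x, y, v) in measure_pmf Q. u = v) /
       Max ((\<lambda>a. \<P>((u, x, y, v) in measure_pmf Q. u = a)) ` A))
    | (A :: nat set) Q. finite A \<and> Q \<in> guess_laws P A}"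

text \<open>Joint laws of (U, X, Y) for which the law of (X, Y) is P, U is a Borel random variable, and
  U - X - Y is a Markov chain.\<close>

definition location_laws ::
  "('x::finite \<times> 'y::finite) pmf \<Rightarrow> ('u::metric_space \<times> 'x \<times> 'y) measure set" where
  "location_laws P = {Q.
     prob_space Q \<and>
     sets Q = sets (borel \<Otimes>\<^sub>M (count_space UNIV :: ('x \<times> 'y) measure)) \<and>
     distr Q (count_space UNIV) (\<lambda>(u, x, y). (x, y)) = measure_pmf P \<and>
     markov_chain Q borel (\<lambda>(u, x, y). u) (\<lambda>(u, x, y). x) (\<lambda>(u, x, y). y)}"

text \<open>The metric space enters through the type \<^typ>\<open>'u\<close>, passed as an explicit type argument.\<close>

definition maximal_locational_leakage ::
  "'u::metric_space itself \<Rightarrow> ('x::finite \<times> 'y::finite) pmf \<Rightarrow> ereal" where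
  "maximal_locational_leakage T P = Sup {elog
      ((SUP g::'y \<Rightarrow> 'u. \<P>((u, x, y) in Q. u \<in> cball (g y) 1)) /
       (SUP c::'u. \<P>((u, x, y) in Q. u \<in> cball c 1)))
    | Q. Q \<in> location_laws P \<and> (\<exists>c::'u. \<P>((u, x, y) in Q. u \<in> cball c 1) > 0)}"

end

theory Submission
  imports Defs
begin

text \<open>Both leakages are compared with the logarithm of the sum over y of the largest P(y|x), x in the
  support of X. For the upper bounds, the Markov property gives
  P(U \<in> B, Y = y) \<le> max P(y|x) P(U \<in> B) for every event B. For attainment, let p be the smallest
  positive probability of a value of X and split each event X = x into finitely many pieces of
  probability at most p, one of them of probability exactly p. If U names the piece, then guessing the
  distinguished piece of a most likely x given y succeeds with probability p times the sum, while each
  value of U has probability at most p. The pieces can be named by points of S, and then a unit ball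
  is no more likely to contain U than a single point.\<close>

section \<open>The sum of maximal likelihoods\<close>

text \<open>The logarithm of the sum of these maxima over y is Sibson's mutual information of order
  infinity.\<close>

definition max_likelihood :: "('x::finite \<times> 'y::finite) pmf \<Rightarrow> 'y \<Rightarrow> real" where
  "max_likelihood P y =
     Max ((\<lambda>x. pmf P (x, y) / pmf (map_pmf fst P) x) ` set_pmf (map_pmf fst P))"

lemma pmf_map_fst_eq_sum:
  fixes P :: "('x::finite \<times> 'y::finite) pmf"
  shows "pmf (map_pmf fst P) x = (\<Sum>y\<in>UNIV. pmf P (x, y))"
proof -
  have "pmf (map_pmf fst P) x = measure (measure_pmf P) (Pair x ` UNIV)"
    by (auto simp: pmf_map intro!: arg_cong[where f = "measure _"])
  also have "\<dots> = (\<Sum>z\<in>Pair x ` UNIV. pmf P z)"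
    by (simp add: measure_measure_pmf_finite)
  also have "\<dots> = (\<Sum>y\<in>UNIV. pmf P (x, y))"
    by (subst sum.reindex) (auto simp: inj_on_def)
  finally show ?thesis .
qed

lemma max_likelihood_ge:
  assumes "x \<in> set_pmf (map_pmf fst P)"
  shows "pmf P (x, y) / pmf (map_pmf fst P) x \<le> max_likelihood P y"
  unfolding max_likelihood_def using assms by (intro Max_ge) auto

lemma max_likelihood_attained:
  obtains x where "x \<in> set_pmf (map_pmf fst P)"
    "max_likelihood P y = pmf P (x, y) / pmf (map_pmf fst P) x"
proof -
  have "max_likelihood P y \<in> (\<lambda>x. pmf P (x, y) / pmf (map_pmf fst P) x) ` set_pmf (map_pmf fst P)"
    unfolding max_likelihood_def by (intro Max_in) (simp_all add: set_pmf_not_empty)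
  then show ?thesis using that by blast
qed

lemma max_likelihood_nonneg: "0 \<le> max_likelihood P y"
  by (metis max_likelihood_attained divide_nonneg_nonneg pmf_nonneg)

text \<open>Any point (x, y) in the support of \<open>P\<close> has P(y|x) > 0, which makes the
  summand of y positive; the other summands are nonnegative.\<close>

lemma sum_max_likelihood_pos: "0 < (\<Sum>y\<in>UNIV. max_likelihood P y)"
proof -
  obtain x y where xy: "(x, y) \<in> set_pmf P"
    using set_pmf_not_empty[of P] by (metis all_not_in_conv surj_pair)
  then have x: "x \<in> set_pmf (map_pmf fst P)"
    by force
  have "0 < pmf P (x, y) / pmf (map_pmf fst P) x"
    using xy x by (simp add: pmf_positive)
  then have "0 < max_likelihood P y"
    using max_likelihood_ge[OF x, of y] by linarith
  then show ?thesis
    by (intro sum_pos2[of _ y]) (auto simp: max_likelihood_nonneg)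
qed

text \<open>The value minus infinity at 0 is what gives monotonicity up to the boundary: the library
  value \<open>ln 0 = 0\<close> exceeds \<open>ln\<close> of small positive numbers.\<close>

lemma elog_mono:
  assumes "0 \<le> r" "r \<le> s"
  shows "elog r \<le> elog s"
  using assms by (auto simp: elog_def)

section \<open>Upper bounds from the Markov property\<close>

text \<open>Given X = x, the Markov property factors P(U \<in> B, Y = y, X = x) as P(y|x) P(U \<in>
  B, X = x); bounding P(y|x) by its maximum and summing over x removes X. The probability space and
  the range of U are left general so that both finite alphabets and Borel laws are covered.\<close>

lemma markov_chain_prob_le:
  fixes P :: "('x::finite \<times> 'y::finite) pmf"
  assumes "prob_space M"
    and U: "U \<in> measurable M N"
    and XY: "(\<lambda>\<omega>. (X \<omega>, Y \<omega>)) \<in> measurable M (count_space UNIV)"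
    and law: "distr M (count_space UNIV) (\<lambda>\<omega>. (X \<omega>, Y \<omega>)) = measure_pmf P"
    and markov: "markov_chain M N U X Y"
    and B: "B \<in> sets N"
  shows "\<P>(\<omega> in M. U \<omega> \<in> B \<and> Y \<omega> = y) \<le> max_likelihood P y * \<P>(\<omega> in M. U \<omega> \<in> B)"
proof -
  interpret prob_space M by fact
  have [measurable]: "X \<in> measurable M (count_space UNIV)" "Y \<in> measurable M (count_space UNIV)"
    using measurable_compose[OF XY, of fst] measurable_compose[OF XY, of snd] by auto
  note U[measurable] B[measurable]
  have law': "\<P>(\<omega> in M. (X \<omega>, Y \<omega>) \<in> C) = measure (measure_pmf P) C" for C
    unfolding law[symmetric] using XY
    by (subst measure_distr) (auto intro!: arg_cong[where f = "measure _"])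
  have px: "\<P>(\<omega> in M. X \<omega> = x) = pmf (map_pmf fst P) x" for x
    using law'[of "fst -` {x}"] by (simp add: pmf_map)
  have pxy: "\<P>(\<omega> in M. Y \<omega> = y \<and> X \<omega> = x) = pmf P (x, y)" for x
    using law'[of "{(x, y)}"] by (simp add: measure_pmf_single conj_commute)
  have le: "\<P>(\<omega> in M. U \<omega> \<in> B \<and> Y \<omega> = y \<and> X \<omega> = x)
      \<le> max_likelihood P y * \<P>(\<omega> in M. U \<omega> \<in> B \<and> X \<omega> = x)" for x
  proof (cases "\<P>(\<omega> in M. X \<omega> = x) > 0")
    case True
    then have x: "x \<in> set_pmf (map_pmf fst P)"
      by (simp only: px pmf_positive_iff)
    have "\<P>(\<omega> in M. U \<omega> \<in> B \<and> Y \<omega> = y \<and> X \<omega> = x)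
        = pmf P (x, y) / pmf (map_pmf fst P) x * \<P>(\<omega> in M. U \<omega> \<in> B \<and> X \<omega> = x)"
      using markov[unfolded markov_chain_def, rule_format, OF B True, of y] True
      unfolding cond_prob_def pxy conj_assoc px by (simp add: field_simps)
    also have "\<dots> \<le> max_likelihood P y * \<P>(\<omega> in M. U \<omega> \<in> B \<and> X \<omega> = x)"
      by (intro mult_right_mono max_likelihood_ge[OF x] measure_nonneg)
    finally show ?thesis .
  next
    \<comment> \<open>The Markov hypothesis says nothing about a null value x, but the left side is
      then 0.\<close>
    case False
    have "\<P>(\<omega> in M. U \<omega> \<in> B \<and> Y \<omega> = y \<and> X \<omega> = x) \<le> \<P>(\<omega> in M. X \<omega> = x)"
      by (intro finite_measure_mono) auto
    with False have "\<P>(\<omega> in M. U \<omega> \<in> B \<and> Y \<omega> = y \<and> X \<omega> = x) \<le> 0"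
      by linarith
    then show ?thesis
      by (rule order_trans) (simp add: max_likelihood_nonneg)
  qed
  have split: "\<P>(\<omega> in M. Q \<omega>) = (\<Sum>x\<in>UNIV. \<P>(\<omega> in M. Q \<omega> \<and> X \<omega> = x))"
    if [measurable]: "Measurable.pred M Q" for Q
    by (rule prob_sum) auto
  have "\<P>(\<omega> in M. U \<omega> \<in> B \<and> Y \<omega> = y)
      = (\<Sum>x\<in>UNIV. \<P>(\<omega> in M. U \<omega> \<in> B \<and> Y \<omega> = y \<and> X \<omega> = x))"
    by (subst split) (auto simp: conj_assoc)
  also have "\<dots> \<le> (\<Sum>x\<in>UNIV. max_likelihood P y * \<P>(\<omega> in M. U \<omega> \<in> B \<and> X \<omega> = x))"
    by (intro sum_mono le)
  also have "\<dots> = max_likelihood P y * \<P>(\<omega> in M. U \<omega> \<in> B)"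
    by (subst split[of "\<lambda>\<omega>. U \<omega> \<in> B"]) (auto simp: sum_distrib_left)
  finally show ?thesis .
qed

text \<open>The guess \<open>g\<close> is an arbitrary function. Since Y has finitely many values,
  the event is a finite union over y of events in which the centre of the ball is fixed.\<close>

lemma measurable_cball_guess:
  fixes Y :: "'w \<Rightarrow> 'y::finite"
  assumes U: "U \<in> borel_measurable M" and Y: "Y \<in> measurable M (count_space UNIV)"
  shows "Measurable.pred M (\<lambda>\<omega>. U \<omega> \<in> cball c r \<and> Y \<omega> = y)"
    and "Measurable.pred M (\<lambda>\<omega>. U \<omega> \<in> cball (g (Y \<omega>)) r)"
proof -
  note Y [measurable]
  have [measurable]: "Measurable.pred M (\<lambda>\<omega>. U \<omega> \<in> cball c r)" for c
    using U by (rule pred_sets2[rotated]) simp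
  show *: "Measurable.pred M (\<lambda>\<omega>. U \<omega> \<in> cball c r \<and> Y \<omega> = y)" for c y
    by measurable
  have "(\<lambda>\<omega>. U \<omega> \<in> cball (g (Y \<omega>)) r) = (\<lambda>\<omega>. \<exists>y. U \<omega> \<in> cball (g y) r \<and> Y \<omega> = y)"
    by auto
  moreover have "Measurable.pred M (\<lambda>\<omega>. \<exists>y. U \<omega> \<in> cball (g y) r \<and> Y \<omega> = y)"
    by (intro pred_intros_countable *)
  ultimately show "Measurable.pred M (\<lambda>\<omega>. U \<omega> \<in> cball (g (Y \<omega>)) r)"
    by (simp only:)
qed

text \<open>On each event Y = y the guess is a fixed centre, so the joint bound applies to the
  closed ball around it, whose probability is at most the denominator. Summing over y bounds the
  numerator for every guess.\<close>

lemma maximal_locational_leakage_le: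
  "maximal_locational_leakage TYPE('u::metric_space) P \<le> elog (\<Sum>y\<in>UNIV. max_likelihood P y)"
  unfolding maximal_locational_leakage_def
proof (rule Sup_least, clarify)
  fix Q :: "('u \<times> 'a \<times> 'b) measure" and c0 :: 'u
  assume Q: "Q \<in> location_laws P" and c0: "0 < \<P>((u, x, y) in Q. u \<in> cball c0 1)"
  interpret prob_space Q
    using Q by (simp add: location_laws_def)
  have [measurable_cong]: "sets Q = sets (borel \<Otimes>\<^sub>M count_space UNIV)"
    using Q by (simp add: location_laws_def)
  let ?U = "\<lambda>\<omega>::'u \<times> 'a \<times> 'b. fst \<omega>"
  let ?X = "\<lambda>\<omega>::'u \<times> 'a \<times> 'b. fst (snd \<omega>)"
  let ?Y = "\<lambda>\<omega>::'u \<times> 'a \<times> 'b. snd (snd \<omega>)"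
  have U: "?U \<in> borel_measurable Q"
    by measurable
  have Y: "?Y \<in> measurable Q (count_space UNIV)"
  proof -
    have "snd \<in> measurable Q (count_space UNIV)"
      by measurable
    then show ?thesis
      by (rule measurable_compose) simp
  qed
  define p where "p c = \<P>(\<omega> in Q. ?U \<omega> \<in> cball c 1)" for c
  \<comment> \<open>The supremum is taken in the reals, so it bounds the values \<open>p c\<close>
    only once boundedness is known.\<close>
  have bdd: "bdd_above (range p)"
    unfolding p_def by (intro bdd_aboveI[of _ 1]) auto
  have p_le: "p c \<le> Sup (range p)" for c
    by (intro cSUP_upper bdd) auto
  have Sup_pos: "0 < Sup (range p)"
    using c0 p_le[of c0] unfolding p_def case_prod_beta prod.collapse by linarith
  have joint: "\<P>(\<omega> in Q. ?U \<omega> \<in> B \<and> ?Y \<omega> = y) \<le> max_likelihood P y * \<P>(\<omega> in Q. ?U \<omega> \<in> B)"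
    if "B \<in> sets borel" for B y
  proof (rule markov_chain_prob_le[where N = borel and X = ?X])
    show "distr Q (count_space UNIV) (\<lambda>\<omega>. (?X \<omega>, ?Y \<omega>)) = measure_pmf P"
      "markov_chain Q borel ?U ?X ?Y"
      using Q by (simp_all add: location_laws_def case_prod_unfold)
  qed (use that in \<open>simp_all add: prob_space_axioms\<close>)
  have le: "\<P>(\<omega> in Q. ?U \<omega> \<in> cball (g (?Y \<omega>)) 1) \<le> (\<Sum>y\<in>UNIV. max_likelihood P y) * Sup (range p)"
    for g
  proof -
    have "\<P>(\<omega> in Q. ?U \<omega> \<in> cball (g (?Y \<omega>)) 1)
        = (\<Sum>y\<in>UNIV. \<P>(\<omega> in Q. ?U \<omega> \<in> cball (g y) 1 \<and> ?Y \<omega> = y))"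
    proof (rule prob_sum)
      show "{\<omega> \<in> space Q. ?U \<omega> \<in> cball (g y) 1 \<and> ?Y \<omega> = y} \<in> events" for y
        using U Y by (intro predE measurable_cball_guess)
      show "{\<omega> \<in> space Q. ?U \<omega> \<in> cball (g (?Y \<omega>)) 1} \<in> events"
        using U Y by (intro predE measurable_cball_guess)
    qed auto
    also have "\<dots> \<le> (\<Sum>y\<in>UNIV. max_likelihood P y * Sup (range p))"
    proof (rule sum_mono)
      fix y
      have "max_likelihood P y * p (g y) \<le> max_likelihood P y * Sup (range p)"
        by (intro mult_left_mono p_le max_likelihood_nonneg)
      then show "\<P>(\<omega> in Q. ?U \<omega> \<in> cball (g y) 1 \<and> ?Y \<omega> = y) \<le> max_likelihood P y * Sup (range p)"
        using joint[of "cball (g y) 1" y] unfolding p_def by simp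
    qed
    finally show ?thesis
      by (simp add: sum_distrib_right)
  qed
  let ?num = "SUP g. \<P>(\<omega> in Q. ?U \<omega> \<in> cball (g (?Y \<omega>)) 1)"
  have "?num \<le> (\<Sum>y\<in>UNIV. max_likelihood P y) * Sup (range p)"
    by (intro cSUP_least le) simp
  \<comment> \<open>\<open>elog_mono\<close> needs a nonnegative argument. Any guess witnesses this;
    \<open>undefined\<close> is an arbitrary centre.\<close>
  moreover have "0 \<le> ?num"
    by (intro cSUP_upper2[where x = "\<lambda>_. undefined"] bdd_aboveI[of _ 1]) auto
  ultimately have "elog (?num / Sup (range p)) \<le> elog (\<Sum>y\<in>UNIV. max_likelihood P y)"
    using Sup_pos by (intro elog_mono) (auto simp: field_simps)
  then show "elog ((SUP g. \<P>((u, x, y) in Q. u \<in> cball (g y) 1)) /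
       (SUP c. \<P>((u, x, y) in Q. u \<in> cball c 1))) \<le> elog (\<Sum>y\<in>UNIV. max_likelihood P y)"
    unfolding p_def case_prod_beta prod.collapse .
qed

text \<open>The guess V may be randomised, but given Y = y it is independent of U. Its success is
  therefore an average, over the values a of V, of P(U = a, Y = y), and each of these is at most the
  maximal likelihood of y times the largest probability of a value of U.\<close>

lemma maximal_leakage_le: "maximal_leakage P \<le> elog (\<Sum>y\<in>UNIV. max_likelihood P y)"
  unfolding maximal_leakage_def
proof (rule Sup_least, clarify)
  fix A :: "nat set" and Q :: "(nat \<times> 'a \<times> 'b \<times> nat) pmf"
  assume A: "finite A" and Q: "Q \<in> guess_laws P A"
  let ?U = "\<lambda>\<omega>::nat \<times> 'a \<times> 'b \<times> nat. fst \<omega>"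
  let ?X = "\<lambda>\<omega>::nat \<times> 'a \<times> 'b \<times> nat. fst (snd \<omega>)"
  let ?Y = "\<lambda>\<omega>::nat \<times> 'a \<times> 'b \<times> nat. fst (snd (snd \<omega>))"
  let ?V = "\<lambda>\<omega>::nat \<times> 'a \<times> 'b \<times> nat. snd (snd (snd \<omega>))"
  define p where "p a = \<P>(\<omega> in Q. ?U \<omega> = a)" for a
  have supp: "set_pmf Q \<subseteq> A \<times> UNIV \<times> UNIV \<times> A"
    and markov_V: "markov_chain Q (count_space UNIV) (\<lambda>\<omega>. (?U \<omega>, ?X \<omega>)) ?Y ?V"
    using Q by (simp_all add: guess_laws_def case_prod_unfold)
  have joint: "\<P>(\<omega> in Q. ?U \<omega> = a \<and> ?Y \<omega> = y) \<le> max_likelihood P y * p a" for a y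
  proof -
    have "\<P>(\<omega> in Q. ?U \<omega> \<in> {a} \<and> ?Y \<omega> = y) \<le> max_likelihood P y * \<P>(\<omega> in Q. ?U \<omega> \<in> {a})"
    proof (rule markov_chain_prob_le[where N = "count_space UNIV" and X = ?X])
      show "distr Q (count_space UNIV) (\<lambda>\<omega>. (?X \<omega>, ?Y \<omega>)) = measure_pmf P"
        using Q by (simp add: guess_laws_def case_prod_unfold flip: map_pmf_rep_eq)
      show "markov_chain Q (count_space UNIV) ?U ?X ?Y"
        using Q by (simp add: guess_laws_def case_prod_unfold)
    qed (simp_all add: measure_pmf.prob_space_axioms)
    then show ?thesis
      by (simp add: p_def)
  qed
  have A_ne: "A \<noteq> {}"
    using supp set_pmf_not_empty[of Q] by auto
  have p_le: "p a \<le> Max (p ` A)" if "a \<in> A" for a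
    using A that by simp
  have Max_nonneg: "0 \<le> Max (p ` A)"
  proof -
    obtain a where "a \<in> A"
      using A_ne by blast
    moreover have "0 \<le> p a"
      by (simp add: p_def)
    ultimately show ?thesis
      using p_le by fastforce
  qed
  have guess: "\<P>(\<omega> in Q. ?U \<omega> = ?V \<omega> \<and> ?Y \<omega> = y) \<le> max_likelihood P y * Max (p ` A)" for y
  proof (cases "\<P>(\<omega> in Q. ?Y \<omega> = y) > 0")
    case True
    \<comment> \<open>The weight of a is P(V = a | Y = y); these weights sum to 1 over
      \<open>A\<close>.\<close>
    let ?c = "\<lambda>a. \<P>(\<omega> in Q. ?V \<omega> = a \<and> ?Y \<omega> = y) / \<P>(\<omega> in Q. ?Y \<omega> = y)"
    have each: "\<P>(\<omega> in Q. (?U \<omega> = ?V \<omega> \<and> ?Y \<omega> = y) \<and> ?V \<omega> = a)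
        \<le> max_likelihood P y * Max (p ` A) * ?c a" if a: "a \<in> A" for a
    proof -
      have "\<P>(\<omega> in Q. (?U \<omega> = ?V \<omega> \<and> ?Y \<omega> = y) \<and> ?V \<omega> = a)
          = \<P>(\<omega> in Q. ((?U \<omega>, ?X \<omega>) \<in> {a} \<times> UNIV \<and> ?V \<omega> = a) \<and> ?Y \<omega> = y)"
        by (intro arg_cong[where f = "measure _"]) auto
      \<comment> \<open>The second Markov property concerns the pair (U, X); the rectangle
        \<open>{a} \<times> UNIV\<close> leaves X free.\<close>
      also have "\<dots> = \<P>(\<omega> in Q. (?U \<omega>, ?X \<omega>) \<in> {a} \<times> UNIV \<and> ?Y \<omega> = y) * ?c a"
        using markov_V[unfolded markov_chain_def, rule_format, of "{a} \<times> UNIV" y a, OF _ True] True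
        unfolding cond_prob_def by (simp add: field_simps)
      also have "\<dots> = \<P>(\<omega> in Q. ?U \<omega> = a \<and> ?Y \<omega> = y) * ?c a"
        by simp
      also have "\<dots> \<le> max_likelihood P y * Max (p ` A) * ?c a"
        by (intro mult_right_mono order_trans[OF joint] mult_left_mono p_le a
            max_likelihood_nonneg divide_nonneg_nonneg measure_nonneg)
      finally show ?thesis .
    qed
    have inA: "AE \<omega> in Q. \<exists>a\<in>A. ?V \<omega> = a"
      using supp by (auto simp: AE_measure_pmf_iff)
    have "\<P>(\<omega> in Q. ?U \<omega> = ?V \<omega> \<and> ?Y \<omega> = y)
        = (\<Sum>a\<in>A. \<P>(\<omega> in Q. (?U \<omega> = ?V \<omega> \<and> ?Y \<omega> = y) \<and> ?V \<omega> = a))"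
      using inA by (intro measure_pmf.prob_sum A) auto
    also have "\<dots> \<le> (\<Sum>a\<in>A. max_likelihood P y * Max (p ` A) * ?c a)"
      by (intro sum_mono each)
    also have "\<dots> = max_likelihood P y * Max (p ` A) * (\<Sum>a\<in>A. ?c a)"
      by (simp add: sum_distrib_left)
    also have "(\<Sum>a\<in>A. ?c a) = (\<Sum>a\<in>A. \<P>(\<omega> in Q. ?Y \<omega> = y \<and> ?V \<omega> = a)) / \<P>(\<omega> in Q. ?Y \<omega> = y)"
      by (simp add: sum_divide_distrib conj_commute)
    also have "(\<Sum>a\<in>A. \<P>(\<omega> in Q. ?Y \<omega> = y \<and> ?V \<omega> = a)) = \<P>(\<omega> in Q. ?Y \<omega> = y)"
      using inA by (intro measure_pmf.prob_sum[symmetric] A) auto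
    finally show ?thesis
      using True by simp
  next
    case False
    have "\<P>(\<omega> in Q. ?U \<omega> = ?V \<omega> \<and> ?Y \<omega> = y) \<le> \<P>(\<omega> in Q. ?Y \<omega> = y)"
      by (intro measure_pmf.finite_measure_mono) auto
    then have "\<P>(\<omega> in Q. ?U \<omega> = ?V \<omega> \<and> ?Y \<omega> = y) \<le> 0"
      using False by linarith
    then show ?thesis
      using Max_nonneg max_likelihood_nonneg[of P y] by (meson mult_nonneg_nonneg order_trans)
  qed
  have "\<P>(\<omega> in Q. ?U \<omega> = ?V \<omega>) = (\<Sum>y\<in>UNIV. \<P>(\<omega> in Q. ?U \<omega> = ?V \<omega> \<and> ?Y \<omega> = y))"
    by (rule measure_pmf.prob_sum) auto
  also have "\<dots> \<le> (\<Sum>y\<in>UNIV. max_likelihood P y) * Max (p ` A)"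
    unfolding sum_distrib_right by (intro sum_mono guess)
  \<comment> \<open>A zero denominator would make the quotient 0 by convention, and positivity of
    the sum settles that case.\<close>
  finally have "\<P>(\<omega> in Q. ?U \<omega> = ?V \<omega>) / Max (p ` A) \<le> (\<Sum>y\<in>UNIV. max_likelihood P y)"
    using Max_nonneg sum_max_likelihood_pos[of P]
    by (cases "Max (p ` A) = 0") (auto simp: divide_le_eq)
  then have "elog (\<P>(\<omega> in Q. ?U \<omega> = ?V \<omega>) / Max (p ` A)) \<le> elog (\<Sum>y\<in>UNIV. max_likelihood P y)"
    using Max_nonneg by (intro elog_mono) auto
  then show "elog (\<P>((u, x, y, v) in Q. u = v) / Max ((\<lambda>a. \<P>((u, x, y, v) in Q. u = a)) ` A))
      \<le> elog (\<Sum>y\<in>UNIV. max_likelihood P y)"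
    unfolding p_def case_prod_beta prod.collapse space_measure_pmf by simp
qed

section \<open>A law attaining the bound\<close>

text \<open>A coin of bias \<open>q\<close> decides between the value 0 and a uniform choice among
  \<open>n\<close> other values. Taking \<open>n\<close> above 1/q gives each of these probability
  (1 - q)/n \<le> q. The value 0 will be the distinguished piece.\<close>

lemma ex_finite_pmf_nat_le:
  fixes q :: real
  assumes "0 < q" "q \<le> 1"
  shows "\<exists>K :: nat pmf. finite (set_pmf K) \<and> pmf K 0 = q \<and> (\<forall>i. pmf K i \<le> q)"
proof -
  obtain n :: nat where "1 / q < n"
    using reals_Archimedean2 by blast
  with assms have n: "1 / n < q" "0 < n"
    by (cases "n = 0"; simp add: field_simps)+
  define K where "K = bind_pmf (bernoulli_pmf q)
    (\<lambda>b. if b then return_pmf 0 else pmf_of_set {1..n})"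
  have pmf_K: "pmf K i = q * indicator {0} i + (1 - q) * (indicator {1..n} i / n)" for i
    using assms n by (auto simp: K_def pmf_bind pmf_of_set indicator_def)
  have "(1 - q) * (1 / n) \<le> 1 * q"
    using assms n by (intro mult_mono) auto
  then have "pmf K i \<le> q" for i
    using assms by (auto simp: pmf_K indicator_def)
  moreover have "pmf K 0 = q"
    by (simp add: pmf_K)
  moreover have "set_pmf K \<subseteq> {0..n}"
    using n by (auto simp: K_def split: if_splits)
  then have "finite (set_pmf K)"
    using finite_subset by blast
  ultimately show ?thesis
    by blast
qed

text \<open>U is drawn from a kernel that sees only x, which builds in the Markov chain U - X - Y.
  The nesting of the triple matches \<open>location_laws\<close>.\<close>

definition channel_joint ::
  "('x \<times> 'y) pmf \<Rightarrow> ('x \<Rightarrow> 'a pmf) \<Rightarrow> ('a \<times> 'x \<times> 'y) pmf" where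
  "channel_joint P K = bind_pmf P (\<lambda>z. map_pmf (\<lambda>u. (u, z)) (K (fst z)))"

lemma map_snd_channel_joint: "map_pmf snd (channel_joint P K) = P"
  by (simp add: channel_joint_def map_bind_pmf pmf.map_comp comp_def bind_return_pmf')

lemma set_channel_joint:
  "fst ` set_pmf (channel_joint P K) \<subseteq> (\<Union>x\<in>set_pmf (map_pmf fst P). set_pmf (K x))"
  by (auto simp: channel_joint_def)

lemma measure_channel_joint:
  fixes P :: "('x::finite \<times> 'y::finite) pmf"
  shows "measure (measure_pmf (channel_joint P K)) E
    = (\<Sum>x\<in>UNIV. \<Sum>y\<in>UNIV. pmf P (x, y) * measure (measure_pmf (K x)) {u. (u, x, y) \<in> E})"
proof -
  \<comment> \<open>Reading the event as a Boolean random variable makes the formula for the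
    \<open>pmf\<close> of a mixture applicable to arbitrary events in an arbitrary alphabet of
    U.\<close>
  have "measure (measure_pmf (channel_joint P K)) E = pmf (map_pmf (\<lambda>\<omega>. \<omega> \<in> E) (channel_joint P K)) True"
    by (simp add: pmf_map vimage_def)
  also have "\<dots> = (\<integral>z. pmf (map_pmf (\<lambda>u. (u, z) \<in> E) (K (fst z))) True \<partial>measure_pmf P)"
    by (simp add: channel_joint_def map_bind_pmf pmf_bind pmf.map_comp comp_def)
  also have "\<dots> = (\<Sum>z\<in>UNIV. pmf P z * measure (measure_pmf (K (fst z))) {u. (u, z) \<in> E})"
    by (subst integral_measure_pmf[of UNIV]) (auto simp: pmf_map vimage_def)
  also have "\<dots> = (\<Sum>x\<in>UNIV. \<Sum>y\<in>UNIV. pmf P (x, y) * measure (measure_pmf (K x)) {u. (u, x, y) \<in> E})"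
    by (simp add: sum.cartesian_product case_prod_unfold)
  finally show ?thesis .
qed

text \<open>Given X = x, the event U \<in> B has probability \<open>K x\<close> of B whatever Y is.
  All events are measurable under a \<open>pmf\<close>, so \<open>N\<close> is free and can be
  discrete or Borel.\<close>

lemma markov_chain_channel_joint:
  fixes P :: "('x::finite \<times> 'y::finite) pmf"
  shows "markov_chain (channel_joint P K) N fst (\<lambda>\<omega>. fst (snd \<omega>)) (\<lambda>\<omega>. snd (snd \<omega>))"
proof -
  let ?R = "channel_joint P K"
  have mass: "(\<Sum>x'\<in>UNIV. \<Sum>y'\<in>UNIV. if x' = x then f x' y' else 0) = (\<Sum>y'\<in>UNIV. f x y')"
    for f :: "'x \<Rightarrow> 'y \<Rightarrow> real" and x
    by (subst sum.swap) simp
  have *: "\<P>(\<omega> in ?R. fst \<omega> \<in> B \<and> fst (snd \<omega>) = x)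
      = pmf (map_pmf fst P) x * measure (measure_pmf (K x)) B" for B x
  proof -
    have "\<P>(\<omega> in ?R. fst \<omega> \<in> B \<and> fst (snd \<omega>) = x)
       = (\<Sum>x'\<in>UNIV. \<Sum>y'\<in>UNIV. if x' = x then pmf P (x, y') * measure (measure_pmf (K x)) B else 0)"
      unfolding measure_channel_joint by (intro sum.cong refl) auto
    then show ?thesis
      by (simp add: mass pmf_map_fst_eq_sum sum_distrib_right)
  qed
  have **: "\<P>(\<omega> in ?R. fst \<omega> \<in> B \<and> snd (snd \<omega>) = y \<and> fst (snd \<omega>) = x)
      = pmf P (x, y) * measure (measure_pmf (K x)) B" for B x y
  proof -
    have "\<P>(\<omega> in ?R. fst \<omega> \<in> B \<and> snd (snd \<omega>) = y \<and> fst (snd \<omega>) = x)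
       = (\<Sum>x'\<in>UNIV. \<Sum>y'\<in>UNIV. if x' = x then
           if y' = y then pmf P (x, y) * measure (measure_pmf (K x)) B else 0 else 0)"
      unfolding measure_channel_joint by (intro sum.cong refl) auto
    then show ?thesis
      by (simp add: mass)
  qed
  show ?thesis
    unfolding markov_chain_def cond_prob_def
    \<comment> \<open>With B = \<open>UNIV\<close> the two formulas give the laws of X and of (X,
      Y), since \<open>K x\<close> has total mass 1.\<close>
    using *[of UNIV, simplified] **[of UNIV, simplified] by (simp add: *[simplified] **[simplified])
qed

text \<open>One construction serves both leakages: \<open>S\<close> is the set of naturals for the
  maximal leakage and the separated set for the locational one. The pair \<open>p\<close>,
  \<open>h\<close> records a cap on the probability of every value of U and a guess of U from
  Y.\<close>

lemma ex_optimal_law: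
  fixes P :: "('x::finite \<times> 'y::finite) pmf" and S :: "'a set"
  assumes "infinite S"
  shows "\<exists>(K :: 'x \<Rightarrow> 'a pmf) A (h :: 'y \<Rightarrow> 'a) p. finite A \<and> A \<subseteq> S \<and> range h \<subseteq> A \<and> 0 < p \<and>
    fst ` set_pmf (channel_joint P K) \<subseteq> A \<and>
    (\<forall>a. \<P>(\<omega> in channel_joint P K. fst \<omega> = a) \<le> p) \<and>
    \<P>(\<omega> in channel_joint P K. fst \<omega> = h (snd (snd \<omega>))) = p * (\<Sum>y\<in>UNIV. max_likelihood P y)"
proof -
  let ?PX = "pmf (map_pmf fst P)" and ?SX = "set_pmf (map_pmf fst P)"
  obtain f :: "nat \<Rightarrow> 'a" where f: "inj f" "range f \<subseteq> S"
    using infinite_countable_subset[OF assms] by blast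
  \<comment> \<open>The point \<open>e x i\<close> of \<open>S\<close> names piece i of the event X
    = x.\<close>
  define e where "e x i = f (to_nat (x :: 'x, i :: nat))" for x i
  have e_eq: "e x i = e x' i' \<longleftrightarrow> x = x' \<and> i = i'" for x i x' i'
    using f(1) by (auto simp: e_def inj_eq)
  define p where "p = Min (?PX ` ?SX)"
  have "p \<in> ?PX ` ?SX"
    unfolding p_def by (intro Min_in) (simp_all add: set_pmf_not_empty)
  then have p_pos: "0 < p"
    by (auto simp only: pmf_positive)
  have p_le: "p \<le> ?PX x" if "x \<in> ?SX" for x
    unfolding p_def using that by (intro Min_le) auto
  \<comment> \<open>This is the conditional probability of the distinguished piece of X = x, chosen
    so that the piece has total probability exactly \<open>p\<close>. Off the support of X, 1 is a
    harmless default lying in the required range.\<close>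
  define q where "q x = (if x \<in> ?SX then p / ?PX x else 1)" for x
  have q: "0 < q x" "q x \<le> 1" for x
    using p_pos p_le[of x] by (auto simp: q_def divide_simps simp del: set_map_pmf dest: pmf_positive)
  obtain K0 where K0: "finite (set_pmf (K0 x))" "pmf (K0 x) 0 = q x" "pmf (K0 x) i \<le> q x"
    for x :: 'x and i :: nat
    using ex_finite_pmf_nat_le[OF q] by metis
  have PX_q: "?PX x * q x \<le> p" for x
    using p_pos by (auto simp: q_def set_pmf_iff simp del: set_map_pmf)
  define K where "K x = map_pmf (e x) (K0 x)" for x
  have pmf_K: "pmf (K x) (e x' i) = (if x = x' then pmf (K0 x) i else 0)" for x x' i
    by (auto simp: K_def e_eq inj_on_def intro!: pmf_map_inj' pmf_map_outside)
  obtain m where m: "m y \<in> ?SX" "max_likelihood P y = pmf P (m y, y) / ?PX (m y)" for y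
  proof -
    have "\<exists>x. x \<in> ?SX \<and> max_likelihood P y = pmf P (x, y) / ?PX x" for y
      by (rule max_likelihood_attained[of P y]) blast
    then show thesis
      using that by metis
  qed
  \<comment> \<open>The maximum likelihood input \<open>m y\<close>, with its distinguished
    piece.\<close>
  define h where "h y = e (m y) 0" for y
  define A where "A = (\<Union>x. set_pmf (K x)) \<union> range h"
  have "finite A"
    by (auto simp: A_def K_def K0)
  moreover have "A \<subseteq> S"
    using f(2) by (auto simp: A_def K_def h_def e_def)
  moreover have "range h \<subseteq> A"
    by (simp add: A_def)
  moreover have "fst ` set_pmf (channel_joint P K) \<subseteq> A"
    using set_channel_joint[of P K] unfolding A_def by blast
  moreover have "\<P>(\<omega> in channel_joint P K. fst \<omega> = a) \<le> p" for a
  proof -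
    have sum: "\<P>(\<omega> in channel_joint P K. fst \<omega> = a) = (\<Sum>x\<in>UNIV. ?PX x * pmf (K x) a)"
      by (simp add: measure_channel_joint measure_pmf_single pmf_map_fst_eq_sum sum_distrib_right)
    show ?thesis
    proof (cases "\<exists>x i. a = e x i")
      case True
      then obtain x i where a: "a = e x i"
        by blast
      have "(\<Sum>x'\<in>UNIV. ?PX x' * pmf (K x') a) = ?PX x * pmf (K0 x) i"
        by (simp add: a pmf_K if_distrib cong: if_cong)
      also have "\<dots> \<le> ?PX x * q x"
        by (intro mult_left_mono K0) simp
      finally show ?thesis
        using PX_q[of x] unfolding sum by linarith
    next
      case False
      then have "pmf (K x) a = 0" for x
        unfolding K_def by (intro pmf_map_outside) auto
      then show ?thesis
        using p_pos unfolding sum by simp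
    qed
  qed
  moreover have "\<P>(\<omega> in channel_joint P K. fst \<omega> = h (snd (snd \<omega>)))
      = p * (\<Sum>y\<in>UNIV. max_likelihood P y)"
  proof -
    have "\<P>(\<omega> in channel_joint P K. fst \<omega> = h (snd (snd \<omega>)))
        = (\<Sum>x\<in>UNIV. \<Sum>y\<in>UNIV. if x = m y then pmf P (m y, y) * q (m y) else 0)"
      by (simp add: measure_channel_joint measure_pmf_single h_def pmf_K K0)
        (intro sum.cong refl, auto simp: K0)
    also have "\<dots> = (\<Sum>y\<in>UNIV. pmf P (m y, y) * q (m y))"
      by (subst sum.swap) simp
    also have "\<dots> = p * (\<Sum>y\<in>UNIV. max_likelihood P y)"
      unfolding sum_distrib_left using m(1) by (intro sum.cong refl) (simp add: m(2) q_def del: set_map_pmf)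
    finally show ?thesis .
  qed
  ultimately show ?thesis
    using p_pos by blast
qed

section \<open>Lower bounds for the two leakages\<close>

text \<open>The optimal law is extended by the deterministic guess V = \<open>h\<close> of Y.
  Success has probability \<open>p\<close> times the sum, and no value of U is likelier than
  \<open>p\<close>.\<close>

lemma maximal_leakage_ge:
  fixes P :: "('x::finite \<times> 'y::finite) pmf"
  shows "elog (\<Sum>y\<in>UNIV. max_likelihood P y) \<le> maximal_leakage P"
proof -
  let ?L = "\<Sum>y\<in>UNIV. max_likelihood P y"
  obtain K :: "'x \<Rightarrow> nat pmf" and A h p where A: "finite A" and h: "range h \<subseteq> A" and p: "0 < p"
    and supp: "fst ` set_pmf (channel_joint P K) \<subseteq> A"
    and le: "\<And>a. \<P>(\<omega> in channel_joint P K. fst \<omega> = a) \<le> p"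
    and eq: "\<P>(\<omega> in channel_joint P K. fst \<omega> = h (snd (snd \<omega>))) = p * ?L"
    using ex_optimal_law[of "UNIV :: nat set" P] by auto
  let ?R = "channel_joint P K"
  define Q where "Q = map_pmf (\<lambda>\<omega>. (fst \<omega>, fst (snd \<omega>), snd (snd \<omega>), h (snd (snd \<omega>)))) ?R"
  have prob_Q: "\<P>(\<omega> in Q. \<Phi> \<omega>) = 
      \<P>(\<omega> in ?R. \<Phi> (fst \<omega>, fst (snd \<omega>), snd (snd \<omega>), h (snd (snd \<omega>))))" for \<Phi>
    by (simp add: Q_def vimage_def)
  have "Q \<in> guess_laws P A"
    unfolding guess_laws_def
  proof (intro CollectI conjI)
    have "map_pmf (\<lambda>(u, x, y, v). (x, y)) Q = map_pmf snd ?R"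
      by (simp add: Q_def pmf.map_comp comp_def case_prod_beta)
    then show "map_pmf (\<lambda>(u, x, y, v). (x, y)) Q = P"
      by (simp add: map_snd_channel_joint)
    show "set_pmf Q \<subseteq> A \<times> UNIV \<times> UNIV \<times> A"
      using supp h by (force simp: Q_def)
    show "markov_chain Q (count_space UNIV) (\<lambda>(u, x, y, v). u) (\<lambda>(u, x, y, v). x) (\<lambda>(u, x, y, v). y)"
      using markov_chain_channel_joint[of P K "count_space UNIV"]
      unfolding markov_chain_def cond_prob_def prob_Q by (simp add: case_prod_beta)
    show "markov_chain Q (count_space UNIV) (\<lambda>(u, x, y, v). (u, x)) (\<lambda>(u, x, y, v). y)
        (\<lambda>(u, x, y, v). v)"
      unfolding markov_chain_def
    proof (intro ballI allI impI)
      fix B y v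
      assume "0 < \<P>(\<omega> in Q. (case \<omega> of (u, x, y, v) \<Rightarrow> y) = y)"
      then have pos: "0 < \<P>(\<omega> in ?R. snd (snd \<omega>) = y)"
        unfolding prob_Q by (simp add: case_prod_beta)
      \<comment> \<open>Given Y = y, V is the constant \<open>h y\<close>, so the event V = v is
        either certain or impossible and the product rule is immediate.\<close>
      have *: "h (snd (snd \<omega>)) = v \<and> snd (snd \<omega>) = y \<longleftrightarrow> h y = v \<and> snd (snd \<omega>) = y"
        for \<omega> :: "nat \<times> 'x \<times> 'y"
        by auto
      show "\<P>(\<omega> in Q. (case \<omega> of (u, x, y, v) \<Rightarrow> (u, x)) \<in> B \<and> (case \<omega> of (u, x, y, v) \<Rightarrow> v) = v
            \<bar> (case \<omega> of (u, x, y, v) \<Rightarrow> y) = y)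
          = \<P>(\<omega> in Q. (case \<omega> of (u, x, y, v) \<Rightarrow> (u, x)) \<in> B \<bar> (case \<omega> of (u, x, y, v) \<Rightarrow> y) = y)
          * \<P>(\<omega> in Q. (case \<omega> of (u, x, y, v) \<Rightarrow> v) = v \<bar> (case \<omega> of (u, x, y, v) \<Rightarrow> y) = y)"
        using pos unfolding cond_prob_def prob_Q unfolding case_prod_beta
        by (cases "h y = v") (simp_all add: *)
    qed
  qed
  let ?num = "\<P>((u, x, y, v) in Q. u = v)"
  let ?den = "Max ((\<lambda>a. \<P>((u, x, y, v) in Q. u = a)) ` A)"
  have num: "?num = p * ?L"
    using eq unfolding case_prod_beta prod.collapse by (simp add: prob_Q[simplified])
  have law_U: "\<P>((u, x, y, v) in Q. u = a) = \<P>(\<omega> in ?R. fst \<omega> = a)" for a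
    unfolding case_prod_beta prod.collapse by (simp add: prob_Q[simplified])
  have A_ne: "A \<noteq> {}"
    using h by auto
  have den_le: "?den \<le> p"
    unfolding law_U using A A_ne le by simp
  \<comment> \<open>Dividing by 0 would yield 0 and lose the bound; a support point of the law shows
    that some value in \<open>A\<close> has positive probability.\<close>
  have "0 < ?den"
  proof -
    obtain \<omega> where \<omega>: "\<omega> \<in> set_pmf ?R"
      using set_pmf_not_empty[of ?R] by blast
    have "0 < pmf ?R \<omega>"
      using \<omega> by (rule pmf_positive)
    also have "pmf ?R \<omega> \<le> \<P>(\<omega>' in ?R. fst \<omega>' = fst \<omega>)"
      unfolding measure_pmf_single[symmetric] by (intro measure_pmf.finite_measure_mono) auto
    also have "\<dots> \<le> ?den"
      unfolding law_U using A supp \<omega> by (intro Max_ge) auto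
    finally show ?thesis .
  qed
  then have "?L \<le> ?num / ?den"
    unfolding num using den_le sum_max_likelihood_pos[of P]
    by (simp add: pos_le_divide_eq mult.commute mult_left_mono)
  then have "elog ?L \<le> elog (?num / ?den)"
    using sum_max_likelihood_pos[of P] by (intro elog_mono) auto
  also have "\<dots> \<le> maximal_leakage P"
    unfolding maximal_leakage_def using A \<open>Q \<in> guess_laws P A\<close> by (intro Sup_upper) blast
  finally show ?thesis .
qed

text \<open>A unit ball contains at most one point of \<open>S\<close>, so it is no likelier than a
  single value of U, hence has probability at most \<open>p\<close>. The points \<open>h y\<close>
  serve as the centres guessed from Y.\<close>

lemma maximal_locational_leakage_ge:
  fixes P :: "('x::finite \<times> 'y::finite) pmf" and S :: "'u::metric_space set"
  assumes "infinite S"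
    and separated: "\<And>s t c. s \<in> S \<Longrightarrow> t \<in> S \<Longrightarrow> s \<in> cball c 1 \<Longrightarrow> t \<in> cball c 1 \<Longrightarrow> s = t"
  shows "elog (\<Sum>y\<in>UNIV. max_likelihood P y) \<le> maximal_locational_leakage TYPE('u) P"
proof -
  let ?L = "\<Sum>y\<in>UNIV. max_likelihood P y"
  obtain K :: "'x \<Rightarrow> 'u pmf" and A h p where "A \<subseteq> S" and p: "0 < p"
    and supp: "fst ` set_pmf (channel_joint P K) \<subseteq> A"
    and le: "\<And>a. \<P>(\<omega> in channel_joint P K. fst \<omega> = a) \<le> p"
    and eq: "\<P>(\<omega> in channel_joint P K. fst \<omega> = h (snd (snd \<omega>))) = p * ?L"
    using ex_optimal_law[of S P] assms(1) by auto
  let ?R = "channel_joint P K"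
  let ?N = "borel \<Otimes>\<^sub>M (count_space UNIV :: ('x \<times> 'y) measure)"
  have space_N: "space ?N = UNIV"
    by (simp add: space_pair_measure)
  \<comment> \<open>The discrete law is carried to the product of the Borel and the discrete
    sigma-algebra that \<open>location_laws\<close> demands; from here on probabilities transfer
    only for events measurable there.\<close>
  define Q :: "('u \<times> 'x \<times> 'y) measure" where "Q = distr ?R ?N (\<lambda>\<omega>. \<omega>)"
  have sets_Q [measurable_cong]: "sets Q = sets ?N"
    by (simp add: Q_def)
  have prob_Q: "\<P>(\<omega> in Q. \<Phi> \<omega>) = \<P>(\<omega> in ?R. \<Phi> \<omega>)" if "Measurable.pred ?N \<Phi>" for \<Phi>
    using that unfolding Q_def by (subst measure_distr) (simp_all add: pred_def space_N)
  have "Q \<in> location_laws P"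
    unfolding location_laws_def
  proof (intro CollectI conjI sets_Q)
    show "prob_space Q"
      unfolding Q_def by (rule measure_pmf.prob_space_distr) (simp add: space_N)
    have "distr Q (count_space UNIV) snd = distr ?R (count_space UNIV) snd"
      unfolding Q_def by (subst distr_distr) (auto simp: comp_def space_N)
    then show "distr Q (count_space UNIV) (\<lambda>(u, x, y). (x, y)) = measure_pmf P"
      by (simp add: case_prod_unfold map_snd_channel_joint flip: map_pmf_rep_eq)
    show "markov_chain Q borel (\<lambda>(u, x, y). u) (\<lambda>(u, x, y). x) (\<lambda>(u, x, y). y)"
      unfolding markov_chain_def
    proof (intro ballI allI impI)
      fix B :: "'u set" and x :: 'x and y :: 'y
      assume B: "B \<in> sets borel" and pos: "0 < \<P>(\<omega> in Q. (case \<omega> of (u, x, y) \<Rightarrow> x) = x)"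
      have snd: "Measurable.pred ?N (\<lambda>\<omega>. snd \<omega> \<in> C)" for C
        by (rule measurable_compose[OF measurable_snd]) simp
      have [measurable]: "Measurable.pred ?N (\<lambda>\<omega>. fst (snd \<omega>) = x)"
          "Measurable.pred ?N (\<lambda>\<omega>. snd (snd \<omega>) = y)"
        using snd[of "fst -` {x}"] snd[of "snd -` {y}"] by simp_all
      have [measurable]: "Measurable.pred ?N (\<lambda>\<omega>. fst \<omega> \<in> B)"
        using B by (intro pred_sets2[OF _ measurable_fst])
      have law: "\<P>(\<omega> in Q. fst (snd \<omega>) = x) = \<P>(\<omega> in ?R. fst (snd \<omega>) = x)"
        "\<P>(\<omega> in Q. fst \<omega> \<in> B \<and> fst (snd \<omega>) = x) = \<P>(\<omega> in ?R. fst \<omega> \<in> B \<and> fst (snd \<omega>) = x)"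
        "\<P>(\<omega> in Q. snd (snd \<omega>) = y \<and> fst (snd \<omega>) = x)
          = \<P>(\<omega> in ?R. snd (snd \<omega>) = y \<and> fst (snd \<omega>) = x)"
        "\<P>(\<omega> in Q. (fst \<omega> \<in> B \<and> snd (snd \<omega>) = y) \<and> fst (snd \<omega>) = x)
          = \<P>(\<omega> in ?R. (fst \<omega> \<in> B \<and> snd (snd \<omega>) = y) \<and> fst (snd \<omega>) = x)"
        by (rule prob_Q, measurable)+
      show "\<P>(\<omega> in Q. (case \<omega> of (u, x, y) \<Rightarrow> u) \<in> B \<and> (case \<omega> of (u, x, y) \<Rightarrow> y) = y
            \<bar> (case \<omega> of (u, x, y) \<Rightarrow> x) = x)
          = \<P>(\<omega> in Q. (case \<omega> of (u, x, y) \<Rightarrow> u) \<in> B \<bar> (case \<omega> of (u, x, y) \<Rightarrow> x) = x)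
          * \<P>(\<omega> in Q. (case \<omega> of (u, x, y) \<Rightarrow> y) = y \<bar> (case \<omega> of (u, x, y) \<Rightarrow> x) = x)"
        using markov_chain_channel_joint[of P K borel, unfolded markov_chain_def cond_prob_def,
            rule_format, OF B, of x y] pos
        unfolding cond_prob_def case_prod_beta law by blast
    qed
  qed
  define d where "d c = \<P>((u, x, y) in Q. u \<in> cball c 1)" for c
  define n where "n g = \<P>((u, x, y) in Q. u \<in> cball (g y) 1)" for g
  have d_eq: "d c = \<P>(\<omega> in ?R. fst \<omega> \<in> cball c 1)" for c
    unfolding d_def case_prod_beta prod.collapse
    by (intro prob_Q pred_sets2[OF _ measurable_fst]) simp
  have n_eq: "n g = \<P>(\<omega> in ?R. fst \<omega> \<in> cball (g (snd (snd \<omega>))) 1)" for g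
    unfolding n_def case_prod_beta prod.collapse
    by (intro prob_Q measurable_cball_guess measurable_fst measurable_compose[OF measurable_snd]) simp
  have d_le: "d c \<le> p" for c
  proof (cases "\<exists>s\<in>A. s \<in> cball c 1")
    case True
    then obtain s where s: "s \<in> A" "s \<in> cball c 1"
      by blast
    \<comment> \<open>U lies in \<open>A\<close> almost surely, and \<open>s\<close> is the only
      point of \<open>A\<close> in this ball.\<close>
    have "d c \<le> \<P>(\<omega> in ?R. fst \<omega> = s)"
      unfolding d_eq using supp s \<open>A \<subseteq> S\<close> separated
      by (intro measure_pmf.finite_measure_mono_AE) (auto simp: AE_measure_pmf_iff image_subset_iff subset_iff)
    then show ?thesis
      using le[of s] by linarith
  next
    case False
    then have "d c = 0"
      unfolding d_eq using supp
      by (intro measure_pmf.prob_eq_0[THEN iffD2]) (auto simp: AE_measure_pmf_iff)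
    then show ?thesis
      using p by simp
  qed
  have d_pos: "\<exists>c. 0 < d c"
  proof -
    obtain \<omega> where \<omega>: "\<omega> \<in> set_pmf ?R"
      using set_pmf_not_empty[of ?R] by blast
    have "pmf ?R \<omega> \<le> d (fst \<omega>)"
      unfolding measure_pmf_single[symmetric] d_eq by (intro measure_pmf.finite_measure_mono) auto
    with pmf_positive[OF \<omega>] have "0 < d (fst \<omega>)"
      by linarith
    then show ?thesis ..
  qed
  have "0 < Sup (range d)"
    using d_pos d_le by (subst less_cSUP_iff) (auto intro!: bdd_aboveI[of _ p])
  moreover have "Sup (range d) \<le> p"
    by (intro cSUP_least d_le) simp
  \<comment> \<open>A correct guess of U is the centre of a ball containing U.\<close>
  moreover have "p * ?L \<le> n h"
    unfolding eq[symmetric] n_eq by (intro measure_pmf.finite_measure_mono) auto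
  moreover have "n h \<le> Sup (range n)"
    unfolding n_eq by (intro cSUP_upper bdd_aboveI[of _ 1]) auto
  ultimately have "?L \<le> Sup (range n) / Sup (range d)"
    using sum_max_likelihood_pos[of P]
    by (simp add: pos_le_divide_eq) (smt (verit) mult.commute mult_left_mono)
  then have "elog ?L \<le> elog (Sup (range n) / Sup (range d))"
    using sum_max_likelihood_pos[of P] by (intro elog_mono) auto
  also have "\<dots> \<le> maximal_locational_leakage TYPE('u) P"
    unfolding maximal_locational_leakage_def n_def d_def
    using \<open>Q \<in> location_laws P\<close> d_pos[unfolded d_def] by (intro Sup_upper) blast
  finally show ?thesis .
qed

theorem theorem3:
  fixes P :: "('x::finite \<times> 'y::finite) pmf"
  shows "maximal_locational_leakage TYPE('u::metric_space) P \<le> maximal_leakage P \<and>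
    ((\<exists>S::'u set. countable S \<and> infinite S \<and>
        (\<forall>s\<in>S. \<forall>t\<in>S. s \<noteq> t \<longrightarrow> \<not> (\<exists>c. {s, t} \<subseteq> cball c 1))) \<longrightarrow>
     maximal_locational_leakage TYPE('u) P = maximal_leakage P)"
proof (intro conjI impI)
  show le: "maximal_locational_leakage TYPE('u) P \<le> maximal_leakage P"
    using maximal_locational_leakage_le maximal_leakage_ge by (rule order_trans)
  assume "\<exists>S::'u set. countable S \<and> infinite S \<and>
    (\<forall>s\<in>S. \<forall>t\<in>S. s \<noteq> t \<longrightarrow> \<not> (\<exists>c. {s, t} \<subseteq> cball c 1))"
  then obtain S :: "'u set" where "infinite S"
    and S: "\<forall>s\<in>S. \<forall>t\<in>S. s \<noteq> t \<longrightarrow> \<not> (\<exists>c. {s, t} \<subseteq> cball c 1)"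
    by (elim exE conjE)
  have "s = t" if "s \<in> S" "t \<in> S" "s \<in> cball c 1" "t \<in> cball c 1" for s t c
    using S that by (metis empty_subsetI insert_subsetI)
  with \<open>infinite S\<close>
  have "elog (\<Sum>y\<in>UNIV. max_likelihood P y) \<le> maximal_locational_leakage TYPE('u) P"
    by (rule maximal_locational_leakage_ge)
  with maximal_leakage_le have "maximal_leakage P \<le> maximal_locational_leakage TYPE('u) P"
    by (rule order_trans)
  with le show "maximal_locational_leakage TYPE('u) P = maximal_leakage P"
    by (rule antisym)
qed

end
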